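(* Let $d\ge1$, $\alpha\in(0,2)$, and let $V:\mathbb{R}^d\to\mathbb{R}$ be a locally bounded Borel measurable function with $e^{-V}\in L^1(dx)$. There is a constant $C_2>0$ such that for each $r>1$, $s>0$ and $f\in C_b^\infty(\mathbb{R}^d)$, $$\int_{B(0,r)}f^2(x)\,\mu_V(dx)\le s\,\mathscr{E}_{\alpha,V}(f,f)+\beta_r(s)\Big(\int_{B(0,r+1)}|f(x)|\,\mu_V(dx)\Big)^2,$$ where $$\beta_r(s)=C_2\,\frac{r^{d+d^2/\alpha}\,K(r)^{1+d/\alpha}}{k(r)^{2+d/\alpha}}\,\big(1+s^{-d/\alpha}\big).$$
   Context: $C_b^\infty(\mathbb{R}^d)$ is the set of smooth functions with bounded derivatives of every order (including order $0$). $B(x,r)$ is the ball with center $x$ and radius $r$. $\mu_V(dx)=C_Ve^{-V(x)}\,dx$ with $C_V=\big(\int e^{-V(x)}dx\big)^{-1}$ is a probability measure. For $r>0$, $k(r):=\inf_{|x|\le r+1}e^{-V(x)}$ and $K(r):=\sup_{|x|\le r}e^{-V(x)}$. The form is $$\mathscr{E}_{\alpha,V}(f,f):=\frac12\iint_{\{|x-y|\le 1\}}\frac{(f(x)-f(y))^2}{|x-y|^{d+\alpha}}\,dy\,\mu_V(dx).$$ *)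

theory Defs
  imports "HOL-Analysis.Analysis"
begin

definition locally_bounded :: "('a::metric_space \<Rightarrow> 'b::metric_space) \<Rightarrow> bool" where
  "locally_bounded V \<longleftrightarrow> (\<forall>x. \<exists>e>0. bounded (V ` ball x e))"

definition partial_deriv :: "'n \<Rightarrow> (real^'n \<Rightarrow> real) \<Rightarrow> real^'n \<Rightarrow> real" where
  "partial_deriv i f x = frechet_derivative f (at x) (axis i 1)"

primrec iter_partial :: "'n list \<Rightarrow> (real^'n \<Rightarrow> real) \<Rightarrow> real^'n \<Rightarrow> real" where
  "iter_partial [] f = f"
| "iter_partial (i # is) f = partial_deriv i (iter_partial is f)"

(* Frechet differentiability of every iterated partial derivative makes all of them
   exist and be continuous, so the first conjunct says that f is of class C-infinity;
   the empty list contributes the boundedness of f itself. *)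
definition Cb_infty :: "(real^'n \<Rightarrow> real) set" where
  "Cb_infty = {f. \<forall>is. (\<forall>x. iter_partial is f differentiable (at x)) \<and>
                       bounded (range (iter_partial is f))}"

definition C_norm :: "(real^'n \<Rightarrow> real) \<Rightarrow> real" where
  "C_norm V = inverse (\<integral>x. exp (- V x) \<partial>lborel)"

definition mu :: "(real^'n \<Rightarrow> real) \<Rightarrow> (real^'n) measure" where
  "mu V = density lborel (\<lambda>x. ennreal (C_norm V * exp (- V x)))"

definition k_low :: "(real^'n \<Rightarrow> real) \<Rightarrow> real \<Rightarrow> real" where
  "k_low V r = (INF x\<in>{x. norm x \<le> r + 1}. exp (- V x))"

definition K_up :: "(real^'n \<Rightarrow> real) \<Rightarrow> real \<Rightarrow> real" where
  "K_up V r = (SUP x\<in>{x. norm x \<le> r}. exp (- V x))"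

(* The quadratic form f \<mapsto> E(f,f), with values in [0,\<infinity>].  On the diagonal
   (a null set) the integrand is 0 / 0 = 0. *)
definition dirichlet_form :: "real \<Rightarrow> (real^'n \<Rightarrow> real) \<Rightarrow> (real^'n \<Rightarrow> real) \<Rightarrow> ennreal" where
  "dirichlet_form \<alpha> V f =
     ennreal (1/2) *
     (\<integral>\<^sup>+x. (\<integral>\<^sup>+y\<in>{y. norm (x - y) \<le> 1}.
        ennreal ((f x - f y)\<^sup>2 / norm (x - y) powr (real CARD('n) + \<alpha>)) \<partial>lborel) \<partial>mu V)"

definition beta :: "real \<Rightarrow> real \<Rightarrow> (real^'n \<Rightarrow> real) \<Rightarrow> real \<Rightarrow> real \<Rightarrow> real" where
  "beta C \<alpha> V r s =
     (let d = real CARD('n) in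
       C * (r powr (d + d\<^sup>2 / \<alpha>) * K_up V r powr (1 + d / \<alpha>) / k_low V r powr (2 + d / \<alpha>))
         * (1 + s powr (- d / \<alpha>)))"

end

(* Compare f(x) with its mean over B(x,t), t <= 1. By Cauchy-Schwarz the squared deviation from
   the mean is at most c t^alpha times the inner integral of the form at x. The mean is at most
   c t^-d times the integral of |f| over B(0,r+1); bounding only one factor of its square this
   way and integrating the other by Fubini costs t^-d instead of t^-2d. The bounds k(r) and K(r)
   pass between mu_V and Lebesgue measure, and t^alpha is chosen proportional to s, cut off at 1.
   The resulting factor K/k^2 is dominated by the one in beta because r > 1 and K >= k. *)
theory Submission
  imports Defs
begin

section \<open>Estimates on small balls for Lebesgue measure\<close>

declare borel_open[OF open_ball, measurable]

lemma ennreal_sum_sq_le: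
  fixes a b :: ennreal
  shows "(a + b)\<^sup>2 \<le> 2 * a\<^sup>2 + 2 * b\<^sup>2"
proof (cases a; cases b)
  fix u v assume *: "a = ennreal u" "0 \<le> u" "b = ennreal v" "0 \<le> v"
  have "(u + v)\<^sup>2 \<le> 2 * u\<^sup>2 + 2 * v\<^sup>2"
    using sum_squares_bound[of u v] by (simp add: power2_sum)
  then have "ennreal ((u + v)\<^sup>2) \<le> ennreal (2 * u\<^sup>2 + 2 * v\<^sup>2)"
    by (rule ennreal_leI)
  moreover have "(a + b)\<^sup>2 = ennreal ((u + v)\<^sup>2)"
    using * by (simp add: ennreal_power flip: ennreal_plus)
  moreover have "2 * a\<^sup>2 + 2 * b\<^sup>2 = ennreal (2 * u\<^sup>2 + 2 * v\<^sup>2)"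
    using * by (simp add: ennreal_power ennreal_mult)
  ultimately show ?thesis
    by simp
qed (auto simp: power2_eq_square ennreal_mult_top ennreal_top_mult)

text \<open>Integrate \<open>\<bar>f x\<bar> \<le> \<bar>f x - f y\<bar> + \<bar>f y\<bar>\<close>
  over y in the ball and square. Cauchy-Schwarz is applied to the difference term alone, which must
  become quadratic to meet the form; the other term stays the square of an L1 integral.\<close>

lemma sq_le_ball_averages:
  fixes f :: "'a::euclidean_space \<Rightarrow> real"
  assumes [measurable]: "f \<in> borel_measurable borel" and "0 < t"
  shows "ennreal ((f x)\<^sup>2) \<le>
      ennreal (2 / measure lborel (ball x t)) * (\<integral>\<^sup>+y\<in>ball x t. ennreal ((f x - f y)\<^sup>2) \<partial>lborel)
      + ennreal (2 / (measure lborel (ball x t))\<^sup>2) * (\<integral>\<^sup>+y\<in>ball x t. ennreal \<bar>f y\<bar> \<partial>lborel)\<^sup>2"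
    (is "_ \<le> _ * ?A2 + _ * ?B\<^sup>2")
proof -
  define m where "m = measure lborel (ball x t)"
  have m: "0 < m" unfolding m_def using \<open>0 < t\<close> by simp
  have em: "emeasure lborel (ball x t) = ennreal m"
    unfolding m_def using emeasure_lborel_ball_finite
    by (intro emeasure_eq_ennreal_measure order.strict_implies_not_eq) auto
  define A where "A = (\<integral>\<^sup>+y\<in>ball x t. ennreal \<bar>f x - f y\<bar> \<partial>lborel)"
  have "ennreal (\<bar>f x\<bar> * m) = (\<integral>\<^sup>+y\<in>ball x t. ennreal \<bar>f x\<bar> \<partial>lborel)"
    using m by (simp add: nn_integral_cmult_indicator em ennreal_mult)
  also have "\<dots> \<le> (\<integral>\<^sup>+y. ennreal \<bar>f x - f y\<bar> * indicator (ball x t) y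
                          + ennreal \<bar>f y\<bar> * indicator (ball x t) y \<partial>lborel)"
    by (intro nn_integral_mono) (auto simp: indicator_def simp flip: ennreal_plus)
  also have "\<dots> = A + ?B"
    unfolding A_def by (intro nn_integral_add) auto
  finally have "(ennreal (\<bar>f x\<bar> * m))\<^sup>2 \<le> (A + ?B)\<^sup>2"
    by (intro power_mono) auto
  also have "\<dots> \<le> 2 * A\<^sup>2 + 2 * ?B\<^sup>2"
    by (rule ennreal_sum_sq_le)
  also have "A\<^sup>2 \<le> (\<integral>\<^sup>+y. (ennreal \<bar>f x - f y\<bar> * indicator (ball x t) y)\<^sup>2 \<partial>lborel)
                  * (\<integral>\<^sup>+y. (indicator (ball x t) y)\<^sup>2 \<partial>lborel)"
    (is "_ \<le> ?X * ?Y")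
  proof -
    \<comment> \<open>The indicator is doubled so that Cauchy-Schwarz can pair the difference with
      an indicator, whose square integrates to the volume \<open>m\<close>.\<close>
    have "A = (\<integral>\<^sup>+y. (ennreal \<bar>f x - f y\<bar> * indicator (ball x t) y) * indicator (ball x t) y \<partial>lborel)"
      unfolding A_def by (intro nn_integral_cong) (auto simp: indicator_def)
    then show ?thesis
      by (simp only:) (intro Cauchy_Schwarz_nn_integral; simp)
  qed
  also have "?X = ?A2"
    by (intro nn_integral_cong) (auto simp: indicator_def ennreal_power)
  also have "?Y = (\<integral>\<^sup>+y. indicator (ball x t) y \<partial>lborel)"
    by (intro nn_integral_cong) (auto simp: indicator_def)
  also have "\<dots> = ennreal m"
    by (simp add: em)
  finally have le: "(ennreal (\<bar>f x\<bar> * m))\<^sup>2 \<le> 2 * (?A2 * ennreal m) + 2 * ?B\<^sup>2"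
    by this (intro add_mono mult_left_mono; simp)
  \<comment> \<open>Dividing by \<open>m\<close> squared cancels the \<open>m\<close> from
    Cauchy-Schwarz, hence the different powers of \<open>m\<close> in the two coefficients.\<close>
  have "ennreal ((f x)\<^sup>2) = ennreal (1 / m\<^sup>2) * (ennreal (\<bar>f x\<bar> * m))\<^sup>2"
    using m by (simp add: ennreal_power power_mult_distrib flip: ennreal_mult)
  also have "\<dots> \<le> ennreal (1 / m\<^sup>2) * (2 * (?A2 * ennreal m) + 2 * ?B\<^sup>2)"
    by (intro mult_left_mono le) auto
  also have "\<dots> = (ennreal (1 / m\<^sup>2) * ennreal 2 * ennreal m) * ?A2
                    + (ennreal (1 / m\<^sup>2) * ennreal 2) * ?B\<^sup>2"
    by (simp add: algebra_simps)
  also have "ennreal (1 / m\<^sup>2) * ennreal 2 * ennreal m = ennreal (2 / m)"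
    using m by (simp add: power2_eq_square del: ennreal_numeral flip: ennreal_mult)
  also have "ennreal (1 / m\<^sup>2) * ennreal 2 = ennreal (2 / m\<^sup>2)"
    using m by (simp del: ennreal_numeral flip: ennreal_mult)
  finally show ?thesis unfolding m_def .
qed

text \<open>On the ball the weight (t / |x - y|)^q is at least 1, and t \<le> 1 keeps the ball
  inside the truncation region of the form. Later q = d + \<alpha>.\<close>

lemma ball_energy_le_kernel_energy:
  fixes f :: "'a::euclidean_space \<Rightarrow> real"
  assumes [measurable]: "f \<in> borel_measurable borel" and "0 < t" "t \<le> 1" "0 \<le> q"
  shows "(\<integral>\<^sup>+y\<in>ball x t. ennreal ((f x - f y)\<^sup>2) \<partial>lborel) \<le>
      ennreal (t powr q) *
        (\<integral>\<^sup>+y\<in>{y. norm (x - y) \<le> 1}. ennreal ((f x - f y)\<^sup>2 / norm (x - y) powr q) \<partial>lborel)"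
proof -
  have "ennreal ((f x - f y)\<^sup>2) * indicator (ball x t) y \<le>
      ennreal (t powr q) * (ennreal ((f x - f y)\<^sup>2 / norm (x - y) powr q)
        * indicator {y. norm (x - y) \<le> 1} y)" for y
  \<comment> \<open>At y = x the kernel is a division by 0, but there the left side vanishes as
    well.\<close>
  proof (cases "y \<in> ball x t \<and> y \<noteq> x")
    case True
    then have y: "0 < norm (x - y)" "norm (x - y) \<le> t"
      by (auto simp: dist_norm)
    have "norm (x - y) powr q \<le> t powr q"
      using y assms by (intro powr_mono2) auto
    then have "(f x - f y)\<^sup>2 \<le> t powr q * ((f x - f y)\<^sup>2 / norm (x - y) powr q)"
      using y mult_right_mono[of _ "t powr q" "(f x - f y)\<^sup>2"] by (simp add: pos_le_divide_eq mult.commute[of "(f x - f y)\<^sup>2"])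
    then show ?thesis
      using True y assms by (auto simp: indicator_def simp flip: ennreal_mult intro!: ennreal_leI)
  qed (auto simp: indicator_def)
  then show ?thesis
    by (subst nn_integral_cmult[symmetric]) (auto intro: nn_integral_mono)
qed

text \<open>By Fubini, each y is counted with the volume of those x within distance t, which is at
  most that of B(y,t) and so independent of y. Since t \<le> 1, only y in B(0,r+1) occur.\<close>

lemma integral_ball_integrals_le:
  fixes g :: "'a::euclidean_space \<Rightarrow> ennreal"
  assumes [measurable]: "g \<in> borel_measurable borel" and "t \<le> 1"
  shows "(\<integral>\<^sup>+x\<in>ball 0 r. (\<integral>\<^sup>+y\<in>ball x t. g y \<partial>lborel) \<partial>lborel) \<le>
      emeasure lborel (ball (0::'a) t) * (\<integral>\<^sup>+y\<in>ball 0 (r + 1). g y \<partial>lborel)"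
proof -
  have "(\<integral>\<^sup>+x\<in>ball 0 r. (\<integral>\<^sup>+y\<in>ball x t. g y \<partial>lborel) \<partial>lborel) =
      (\<integral>\<^sup>+x. (\<integral>\<^sup>+y. g y * indicator {y. dist x y < t} y * indicator (ball 0 r) x \<partial>lborel) \<partial>lborel)"
    by (intro nn_integral_cong) (simp add: nn_integral_multc ball_def)
  \<comment> \<open>The restriction on x is traded for the weaker one on y, so that after the
    exchange the inner integral is a full ball volume.\<close>
  also have "\<dots> \<le> (\<integral>\<^sup>+x. (\<integral>\<^sup>+y. (g y * indicator (ball 0 (r + 1)) y) * indicator {x. dist y x < t} x \<partial>lborel) \<partial>lborel)"
  proof (intro nn_integral_mono)
    fix x y :: 'a
    have "norm y < r + 1" if "dist x y < t" "norm x < r"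
      using that \<open>t \<le> 1\<close> norm_triangle_ineq2[of y x] by (simp add: dist_norm norm_minus_commute)
    then show "g y * indicator {y. dist x y < t} y * indicator (ball 0 r) x
        \<le> g y * indicator (ball 0 (r + 1)) y * indicator {x. dist y x < t} x"
      by (auto simp: indicator_def dist_commute)
  qed
  also have "\<dots> = (\<integral>\<^sup>+y. (\<integral>\<^sup>+x. (g y * indicator (ball 0 (r + 1)) y) * indicator {x. dist y x < t} x \<partial>lborel) \<partial>lborel)"
    by (intro lborel_pair.Fubini') (simp add: indicator_def)
  also have "\<dots> = (\<integral>\<^sup>+y. (g y * indicator (ball 0 (r + 1)) y) * emeasure lborel (ball (0::'a) t) \<partial>lborel)"
  proof (intro nn_integral_cong)
    fix y :: 'a
    have "emeasure lborel (ball y t) = emeasure lborel (ball (0::'a) t)"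
      by (cases "0 \<le> t") (simp_all add: emeasure_ball ball_empty)
    then show "(\<integral>\<^sup>+x. (g y * indicator (ball 0 (r + 1)) y) * indicator {x. dist y x < t} x \<partial>lborel)
        = (g y * indicator (ball 0 (r + 1)) y) * emeasure lborel (ball (0::'a) t)"
      by (simp add: nn_integral_cmult flip: ball_def)
  qed
  also have "\<dots> = emeasure lborel (ball (0::'a) t) * (\<integral>\<^sup>+y\<in>ball 0 (r + 1). g y \<partial>lborel)"
    by (subst nn_integral_multc) (measurable, rule mult.commute)
  finally show ?thesis .
qed

section \<open>The inequality at a fixed radius t for a general density\<close>

text \<open>The radius t remains free, to be tuned to s later. The upper bound on \<open>p\<close>
  serves the outer variable x in B(0,r), the lower bound the inner variable y, which can reach
  B(0,r+1).\<close>

lemma local_super_poincare: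
  fixes f p :: "'a::euclidean_space \<Rightarrow> real"
  assumes [measurable]: "f \<in> borel_measurable borel" "p \<in> borel_measurable borel"
    and t: "0 < t" "t \<le> 1" and q: "0 \<le> q" and k: "0 < k"
    and upper: "\<And>x. x \<in> ball 0 r \<Longrightarrow> p x \<le> K"
    and lower: "\<And>x. x \<in> ball 0 (r + 1) \<Longrightarrow> k \<le> p x"
  defines "M \<equiv> density lborel (\<lambda>x. ennreal (p x))"
    and "m \<equiv> measure lborel (ball (0::'a) t)"
  shows "(\<integral>\<^sup>+x\<in>ball 0 r. ennreal ((f x)\<^sup>2) \<partial>M) \<le>
      ennreal (2 * t powr q / m) *
        (\<integral>\<^sup>+x. (\<integral>\<^sup>+y\<in>{y. norm (x - y) \<le> 1}.
            ennreal ((f x - f y)\<^sup>2 / norm (x - y) powr q) \<partial>lborel) \<partial>M)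
      + ennreal (2 * K / (m * k\<^sup>2)) * (\<integral>\<^sup>+x\<in>ball 0 (r + 1). ennreal \<bar>f x\<bar> \<partial>M)\<^sup>2"
proof -
  define G where "G x = (\<integral>\<^sup>+y\<in>{y. norm (x - y) \<le> 1}.
            ennreal ((f x - f y)\<^sup>2 / norm (x - y) powr q) \<partial>lborel)" for x
  define B where "B x = (\<integral>\<^sup>+y\<in>ball x t. ennreal \<bar>f y\<bar> \<partial>lborel)" for x
  define I where "I = (\<integral>\<^sup>+y\<in>ball 0 (r + 1). ennreal \<bar>f y\<bar> \<partial>lborel)"
  define J where "J = (\<integral>\<^sup>+y\<in>ball 0 (r + 1). ennreal \<bar>f y\<bar> \<partial>M)"
  have [measurable]: "G \<in> borel_measurable borel"
    unfolding G_def[abs_def] indicator_def by measurable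
  have [measurable]: "B \<in> borel_measurable borel"
    unfolding B_def[abs_def] indicator_def ball_def by measurable
  have m: "0 < m" unfolding m_def using t by simp
  have mx: "measure lborel (ball x t) = m" for x :: 'a
    unfolding m_def using t by (simp add: content_ball)
  have em: "emeasure lborel (ball (0::'a) t) = ennreal m"
    unfolding m_def using emeasure_lborel_ball_finite
    by (intro emeasure_eq_ennreal_measure order.strict_implies_not_eq) auto
  have BI: "B x \<le> I" if "x \<in> ball 0 r" for x
    unfolding B_def I_def
  proof (intro nn_integral_mono mult_left_mono)
    fix y
    have "norm y < r + 1" if "dist x y < t"
      using that \<open>x \<in> ball 0 r\<close> t norm_triangle_ineq2[of y x]
      by (simp add: dist_norm norm_minus_commute)
    then show "(indicator (ball x t) y :: ennreal) \<le> indicator (ball 0 (r + 1)) y"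
      by (auto simp: indicator_def)
  qed simp
  have pointwise: "ennreal ((f x)\<^sup>2) \<le> ennreal (2 * t powr q / m) * G x + ennreal (2 / m\<^sup>2) * (B x)\<^sup>2" for x
  proof -
    have "ennreal ((f x)\<^sup>2) \<le> ennreal (2 / m) * (\<integral>\<^sup>+y\<in>ball x t. ennreal ((f x - f y)\<^sup>2) \<partial>lborel)
        + ennreal (2 / m\<^sup>2) * (B x)\<^sup>2"
      using sq_le_ball_averages[of f t x] t by (simp add: mx B_def)
    also have "\<dots> \<le> ennreal (2 / m) * (ennreal (t powr q) * G x) + ennreal (2 / m\<^sup>2) * (B x)\<^sup>2"
      unfolding G_def using t q by (intro add_mono mult_left_mono ball_energy_le_kernel_energy) auto
    also have "ennreal (2 / m) * (ennreal (t powr q) * G x) = ennreal (2 * t powr q / m) * G x"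
      using m by (simp flip: mult.assoc ennreal_mult)
    finally show ?thesis .
  qed
  \<comment> \<open>The energy term may be extended to the whole space; the mean term keeps its
    indicator, as \<open>B x\<close> is controlled by \<open>I\<close> only on B(0,r).\<close>
  have "(\<integral>\<^sup>+x\<in>ball 0 r. ennreal ((f x)\<^sup>2) \<partial>M) \<le>
      (\<integral>\<^sup>+x. ennreal (2 * t powr q / m) * G x
        + ennreal (2 / m\<^sup>2) * ((B x)\<^sup>2 * indicator (ball 0 r) x) \<partial>M)"
    using pointwise by (intro nn_integral_mono) (auto simp: indicator_def)
  also have "\<dots> = ennreal (2 * t powr q / m) * (\<integral>\<^sup>+x. G x \<partial>M)
      + ennreal (2 / m\<^sup>2) * (\<integral>\<^sup>+x\<in>ball 0 r. (B x)\<^sup>2 \<partial>M)"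
    unfolding M_def by (subst nn_integral_add, measurable) (simp_all add: nn_integral_cmult)
  also have "(\<integral>\<^sup>+x\<in>ball 0 r. (B x)\<^sup>2 \<partial>M) \<le> ennreal (K * m / k\<^sup>2) * J\<^sup>2"
  proof (cases "ball (0::'a) r = {}")
    case False
    then have "0 < r" by (simp add: ball_eq_empty not_le)
    \<comment> \<open>The origin lies in both balls, so \<open>k \<le> p 0 \<le> K\<close>. In the
      empty case the integral is simply 0.\<close>
    then have K: "0 \<le> K"
      using upper[of 0] lower[of 0] k by auto
    have "(\<integral>\<^sup>+x\<in>ball 0 r. (B x)\<^sup>2 \<partial>M) =
        (\<integral>\<^sup>+x. ennreal (p x) * ((B x)\<^sup>2 * indicator (ball 0 r) x) \<partial>lborel)"
      unfolding M_def by (subst nn_integral_density) auto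
    \<comment> \<open>Bounding both factors \<open>B x\<close> by \<open>I\<close> would produce the
      volume of B(0,r); keeping one for Fubini produces the small volume \<open>m\<close>.\<close>
    also have "\<dots> \<le> (\<integral>\<^sup>+x. ennreal K * I * (B x * indicator (ball 0 r) x) \<partial>lborel)"
    proof (intro nn_integral_mono)
      fix x
      show "ennreal (p x) * ((B x)\<^sup>2 * indicator (ball 0 r) x) \<le> ennreal K * I * (B x * indicator (ball 0 r) x)"
      proof (cases "x \<in> ball 0 r")
        case True
        then have "ennreal (p x) * (B x * B x) \<le> ennreal K * (I * B x)"
          by (intro mult_mono BI ennreal_leI upper) auto
        then show ?thesis
          using True by (simp add: power2_eq_square mult.assoc)
      qed simp
    qed
    also have "\<dots> = ennreal K * I * (\<integral>\<^sup>+x\<in>ball 0 r. B x \<partial>lborel)"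
      by (simp add: nn_integral_cmult)
    also have "\<dots> \<le> ennreal K * I * (ennreal m * I)"
      using integral_ball_integrals_le[of "\<lambda>y. ennreal \<bar>f y\<bar>" t r] t
      by (intro mult_left_mono) (auto simp: em B_def I_def)
    also have "\<dots> = ennreal (K * m) * I\<^sup>2"
      using K m by (simp add: ennreal_mult power2_eq_square ac_simps)
    \<comment> \<open>Here 1 \<le> p / k on B(0,r+1) turns Lebesgue measure into \<open>M\<close>;
      \<open>I\<close> enters squared, which is the source of \<open>k\<close> squared.\<close>
    also have "I \<le> ennreal (1 / k) * J"
    proof -
      have "I \<le> (\<integral>\<^sup>+y. ennreal (1 / k) * (ennreal (p y) * (ennreal \<bar>f y\<bar> * indicator (ball 0 (r + 1)) y)) \<partial>lborel)"
        unfolding I_def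
      proof (intro nn_integral_mono)
        fix y
        show "ennreal \<bar>f y\<bar> * indicator (ball 0 (r + 1)) y \<le>
            ennreal (1 / k) * (ennreal (p y) * (ennreal \<bar>f y\<bar> * indicator (ball 0 (r + 1)) y))"
        proof (cases "y \<in> ball 0 (r + 1)")
          case True
          then have "k \<le> p y" by (rule lower)
          then have "\<bar>f y\<bar> \<le> 1 / k * (p y * \<bar>f y\<bar>)"
            using k by (simp add: field_simps mult_right_mono)
          then show ?thesis
            using True k \<open>k \<le> p y\<close> by (simp add: ennreal_leI flip: ennreal_mult)
        qed simp
      qed
      also have "\<dots> = ennreal (1 / k) * J"
        unfolding J_def M_def by (subst nn_integral_cmult, simp, subst nn_integral_density) auto
      finally show ?thesis .
    qed
    also have "ennreal (K * m) * (ennreal (1 / k) * J)\<^sup>2 = ennreal (K * m / k\<^sup>2) * J\<^sup>2"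
      using K m k by (simp add: power_mult_distrib ennreal_power power_divide flip: mult.assoc ennreal_mult)
    finally show ?thesis
      by this (intro mult_left_mono power_mono; simp)
  next
    case True
    show ?thesis by (simp only: True) simp
  qed
  also have "ennreal (2 / m\<^sup>2) * (ennreal (K * m / k\<^sup>2) * J\<^sup>2) = ennreal (2 * K / (m * k\<^sup>2)) * J\<^sup>2"
    using m by (simp add: power2_eq_square flip: mult.assoc ennreal_mult')
  finally show ?thesis
    unfolding G_def J_def by this (intro add_left_mono mult_left_mono; simp)
qed

section \<open>Consequences of the assumptions on V and f\<close>

text \<open>By compactness, finitely many of the balls on which V is bounded cover the closed
  ball.\<close>

lemma locally_bounded_imp_bounded_cball:
  fixes V :: "'a::heine_borel \<Rightarrow> 'b::metric_space"
  assumes "locally_bounded V"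
  shows "bounded (V ` cball x r)"
proof -
  obtain e where e: "\<And>x. 0 < e x" "\<And>x. bounded (V ` ball x (e x))"
    using assms unfolding locally_bounded_def by metis
  have "cball x r \<subseteq> (\<Union>z\<in>cball x r. ball z (e z))"
    using e(1) by force
  then obtain Z where Z: "finite Z" "cball x r \<subseteq> (\<Union>z\<in>Z. ball z (e z))"
    by (rule compactE_image[OF compact_cball open_ball])
  then have "V ` cball x r \<subseteq> (\<Union>z\<in>Z. V ` ball z (e z))"
    by blast
  moreover have "bounded (\<Union>z\<in>Z. V ` ball z (e z))"
    using Z(1) e(2) by (intro bounded_UN) auto
  ultimately show ?thesis
    by (rule bounded_subset[rotated])
qed

lemma Cb_infty_borel_measurable:
  assumes "f \<in> Cb_infty"
  shows "f \<in> borel_measurable borel"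
proof -
  \<comment> \<open>The empty list of partial derivatives stands for f itself.\<close>
  have "f differentiable (at x)" for x
    using assms unfolding Cb_infty_def by (force dest: spec[of _ "[]"])
  then show ?thesis
    by (intro borel_measurable_continuous_onI continuous_at_imp_continuous_on)
      (auto intro: differentiable_imp_continuous_within)
qed

text \<open>A bound c for |V| on the closed ball makes exp(-c) a positive lower bound, so the real
  infimum is a genuine one. Its positivity also needs the ball to be nonempty, hence
  \<open>0 \<le> r + 1\<close>.\<close>

lemma k_low_bounds:
  fixes V :: "real^'n \<Rightarrow> real"
  assumes "locally_bounded V"
  shows "0 \<le> r + 1 \<Longrightarrow> 0 < k_low V r" and "norm x \<le> r + 1 \<Longrightarrow> k_low V r \<le> exp (- V x)"
proof -
  obtain c where c: "\<forall>x\<in>cball 0 (r + 1). \<bar>V x\<bar> \<le> c"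
    using locally_bounded_imp_bounded_cball[OF assms, of 0 "r + 1"]
    by (auto simp: bounded_iff)
  have "exp (- c) \<le> exp (- V x)" if "norm x \<le> r + 1" for x
    using bspec[OF c, of x] that by simp
  then have lower: "\<forall>x\<in>{x. norm x \<le> r + 1}. exp (- c) \<le> exp (- V x)"
    by blast
  show "0 < k_low V r" if "0 \<le> r + 1"
  proof -
    have "{x::real^'n. norm x \<le> r + 1} \<noteq> {}"
      using that by (auto intro!: exI[of _ 0])
    then have "exp (- c) \<le> k_low V r"
      unfolding k_low_def using lower by (intro cINF_greatest) auto
    then show ?thesis
      by (rule less_le_trans[OF exp_gt_zero])
  qed
  show "k_low V r \<le> exp (- V x)" if "norm x \<le> r + 1"
    unfolding k_low_def using that lower by (intro cINF_lower bdd_belowI2) auto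
qed

lemma K_up_upper:
  fixes V :: "real^'n \<Rightarrow> real"
  assumes "locally_bounded V" and "norm x \<le> r"
  shows "exp (- V x) \<le> K_up V r"
proof -
  obtain c where c: "\<forall>x\<in>cball 0 r. \<bar>V x\<bar> \<le> c"
    using locally_bounded_imp_bounded_cball[OF assms(1), of 0 r]
    by (auto simp: bounded_iff)
  have "exp (- V x) \<le> exp c" if "norm x \<le> r" for x
    using bspec[OF c, of x] that by simp
  then show ?thesis
    unfolding K_up_def using assms(2) by (intro cSUP_upper bdd_aboveI2) auto
qed

text \<open>A zero integral would force exp(-V) to vanish almost everywhere, yet it is positive on a
  space that is not null. Integrability matters: otherwise the integral, and with it
  \<open>C_norm V\<close>, would default to 0.\<close>

lemma C_norm_pos:
  assumes "integrable lborel (\<lambda>x. exp (- V x))"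
  shows "0 < C_norm V"
proof -
  have "(\<integral>x. exp (- V x) \<partial>lborel) \<noteq> 0"
    using integral_nonneg_eq_0_iff_AE[OF assms] by (simp add: AE_iff_null null_sets_def)
  moreover have "0 \<le> (\<integral>x. exp (- V x) \<partial>lborel)"
    by simp
  ultimately have "0 < (\<integral>x. exp (- V x) \<partial>lborel)"
    by linarith
  then show ?thesis
    by (simp add: C_norm_def)
qed

section \<open>Choice of the radius and of the constant\<close>

theorem proposition2p2:
  fixes V :: "real^'n \<Rightarrow> real" and \<alpha> :: real
  assumes "0 < \<alpha>" and "\<alpha> < 2"
    and "V \<in> borel_measurable borel"
    and "locally_bounded V"
    and "integrable lborel (\<lambda>x. exp (- V x))"
  shows "\<exists>C\<^sub>2>0. \<forall>r>1. \<forall>s>0. \<forall>f\<in>Cb_infty.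
    (\<integral>\<^sup>+x\<in>ball 0 r. ennreal ((f x)\<^sup>2) \<partial>mu V)
      \<le> ennreal s * dirichlet_form \<alpha> V f
        + ennreal (beta C\<^sub>2 \<alpha> V r s) * (\<integral>\<^sup>+x\<in>ball 0 (r + 1). ennreal \<bar>f x\<bar> \<partial>mu V)\<^sup>2"
proof -
  note [measurable] = assms(3)
  define d where "d = real CARD('n)"
  define w where "w = unit_ball_vol d"
  define c where "c = C_norm V"
  \<comment> \<open>\<open>D\<close> absorbs the factor (w/4)^(-d/\<alpha>) that appears when t^(-d)
    is expressed through s. \<open>C\<close> is then built from d, \<alpha> and V alone, so it is
    uniform in r, s and f.\<close>
  define D where "D = 1 + (w / 4) powr (- d / \<alpha>)"
  define C where "C = 2 * D / (w * c)"
  have d: "0 < d" by (simp add: d_def)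
  have w: "0 < w" using d by (simp add: w_def)
  have c: "0 < c" using C_norm_pos[OF assms(5)] by (simp add: c_def)
  have D: "0 < D" by (simp add: D_def add_pos_nonneg)
  have C: "0 < C" using D w c by (simp add: C_def)
  show ?thesis
  proof (intro exI[of _ C] conjI allI impI ballI C)
    fix r s :: real and f :: "real^'n \<Rightarrow> real"
    assume r: "1 < r" and s: "0 < s" and "f \<in> Cb_infty"
    note [measurable] = Cb_infty_borel_measurable[OF \<open>f \<in> Cb_infty\<close>]
    define k where "k = k_low V r"
    define K where "K = K_up V r"
    have k: "0 < k" unfolding k_def using r assms(4) by (intro k_low_bounds) auto
    have kK: "k \<le> K"
      unfolding k_def K_def using k_low_bounds(2)[OF assms(4), of 0 r] K_up_upper[OF assms(4), of 0 r] r
      by simp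
    \<comment> \<open>This is the largest t \<le> 1 with t^\<alpha> \<le> s w / 4. The 4 makes the
      energy coefficient 2 t^\<alpha> / w at most s / 2, matching the factor 1/2 in the
      form.\<close>
    define t where "t = min 1 ((s * w / 4) powr (1 / \<alpha>))"
    have t: "0 < t" "t \<le> 1" using s w by (auto simp: t_def)
    have m: "measure lborel (ball (0::real^'n) t) = w * t powr d"
      using t by (simp add: content_ball w_def d_def powr_realpow)
    have "t powr \<alpha> \<le> ((s * w / 4) powr (1 / \<alpha>)) powr \<alpha>"
      using t assms(1) by (intro powr_mono2) (auto simp: t_def)
    then have ta: "t powr \<alpha> \<le> s * w / 4"
      using assms(1) s w by (simp add: powr_powr)
    have tq: "2 * t powr (d + \<alpha>) / (w * t powr d) \<le> s / 2"
      using ta w t by (simp add: powr_add field_simps)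
    \<comment> \<open>By the minimum in \<open>t\<close>, the left side is the larger of the two
      summands on the right.\<close>
    have "t powr (- d) \<le> 1 + (s * w / 4) powr (- d / \<alpha>)"
    proof (cases "1 \<le> (s * w / 4) powr (1 / \<alpha>)")
      case False
      then have "t = (s * w / 4) powr (1 / \<alpha>)" by (simp add: t_def)
      then show ?thesis by (simp add: powr_powr)
    qed (simp add: t_def)
    also have "(s * w / 4) powr (- d / \<alpha>) = (w / 4) powr (- d / \<alpha>) * s powr (- d / \<alpha>)"
      using s w by (simp flip: powr_mult add: mult.commute)
    also have "1 + (w / 4) powr (- d / \<alpha>) * s powr (- d / \<alpha>) \<le> D * (1 + s powr (- d / \<alpha>))"
      by (simp add: D_def algebra_simps)
    finally have td: "1 / t powr d \<le> D * (1 + s powr (- d / \<alpha>))"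
      by (simp add: powr_minus inverse_eq_divide)
    have ratio: "K / k\<^sup>2 \<le> r powr (d + d\<^sup>2 / \<alpha>) * K powr (1 + d / \<alpha>) / k powr (2 + d / \<alpha>)"
    proof -
      have "1 \<le> r powr (d + d\<^sup>2 / \<alpha>)"
        using r d assms(1) by (intro ge_one_powr_ge_zero) auto
      moreover have "1 \<le> (K / k) powr (d / \<alpha>)"
        using kK k d assms(1) by (intro ge_one_powr_ge_zero) auto
      ultimately have "1 * 1 \<le> r powr (d + d\<^sup>2 / \<alpha>) * (K / k) powr (d / \<alpha>)"
        by (intro mult_mono) auto
      \<comment> \<open>The factor in \<open>beta\<close> is exactly \<open>K / k\<^sup>2\<close>
        times these two powers, each at least 1.\<close>
      then have "K / k\<^sup>2 * 1 \<le> K / k\<^sup>2 * (r powr (d + d\<^sup>2 / \<alpha>) * (K / k) powr (d / \<alpha>))"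
        using k kK by (intro mult_left_mono) auto
      also have "\<dots> = r powr (d + d\<^sup>2 / \<alpha>) * K powr (1 + d / \<alpha>) / k powr (2 + d / \<alpha>)"
        using k kK by (simp add: powr_add powr_divide)
      finally show ?thesis by simp
    qed
    \<comment> \<open>The normalising constant occurs once above and squared below, leaving the
      \<open>c\<close> in the denominator of \<open>C\<close>.\<close>
    have "2 * (c * K) / (w * t powr d * (c * k)\<^sup>2) = 2 / (w * c) * (K / k\<^sup>2) * (1 / t powr d)"
      using c by (simp add: power2_eq_square field_simps)
    also have "\<dots> \<le> 2 / (w * c) * (r powr (d + d\<^sup>2 / \<alpha>) * K powr (1 + d / \<alpha>) / k powr (2 + d / \<alpha>))
        * (D * (1 + s powr (- d / \<alpha>)))"
      using w c k kK by (intro mult_mono ratio td order.refl) auto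
    also have "\<dots> = beta C \<alpha> V r s"
      unfolding beta_def Let_def C_def d_def[symmetric] k_def[symmetric] K_def[symmetric]
      by (simp add: mult_ac)
    finally have beta: "2 * (c * K) / (w * t powr d * (c * k)\<^sup>2) \<le> beta C \<alpha> V r s" .
    let ?E = "\<integral>\<^sup>+x. (\<integral>\<^sup>+y\<in>{y. norm (x - y) \<le> 1}.
            ennreal ((f x - f y)\<^sup>2 / norm (x - y) powr (d + \<alpha>)) \<partial>lborel) \<partial>mu V"
    let ?J = "\<integral>\<^sup>+x\<in>ball 0 (r + 1). ennreal \<bar>f x\<bar> \<partial>mu V"
    have "(\<integral>\<^sup>+x\<in>ball 0 r. ennreal ((f x)\<^sup>2) \<partial>mu V) \<le>
        ennreal (2 * t powr (d + \<alpha>) / (w * t powr d)) * ?E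
        + ennreal (2 * (c * K) / (w * t powr d * (c * k)\<^sup>2)) * ?J\<^sup>2"
      unfolding mu_def c_def[symmetric] m[symmetric]
    \<comment> \<open>The density is \<open>c * exp (- V x)\<close> and q = d + \<alpha>; the bounds
      k and K are scaled by \<open>c\<close> accordingly.\<close>
    proof (rule local_super_poincare)
      show "c * exp (- V x) \<le> c * K" if "x \<in> ball 0 r" for x
        unfolding K_def using that c assms(4) by (intro mult_left_mono K_up_upper) auto
      show "c * k \<le> c * exp (- V x)" if "x \<in> ball 0 (r + 1)" for x
        unfolding k_def using that c assms(4) by (intro mult_left_mono k_low_bounds(2)) auto
    qed (use t d c k assms(1) in auto)
    also have "\<dots> \<le> ennreal (s / 2) * ?E + ennreal (beta C \<alpha> V r s) * ?J\<^sup>2"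
      using tq beta by (intro add_mono mult_right_mono ennreal_leI) auto
    also have "ennreal (s / 2) * ?E = ennreal s * dirichlet_form \<alpha> V f"
      unfolding dirichlet_form_def d_def[symmetric] using s
      by (simp only: mult.assoc[symmetric] ennreal_mult'[symmetric]) simp
    finally show "(\<integral>\<^sup>+x\<in>ball 0 r. ennreal ((f x)\<^sup>2) \<partial>mu V)
      \<le> ennreal s * dirichlet_form \<alpha> V f + ennreal (beta C \<alpha> V r s) * ?J\<^sup>2" .
  qed
qed

end
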